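(* Let $g$ lie in $\mathcal{D}^p\cap\mathcal{K}^p$ for some $p\in\mathbb{N}$. The following assertions hold. (a) For any $x>0$ we have $$\Sigma g(x)=-g(x)+\sum_{j=1}^p\binom{x}{j}\Delta^{j-1}g(1)-\sum_{k=1}^{\infty}\left(g(x+k)-\sum_{j=0}^p\binom{x}{j}\Delta^jg(k)\right)$$ and the series converges uniformly on any bounded subset of $[0,\infty)$. (b) If $g$ lies in $\mathcal{C}^0$, then $\Sigma g$ lies in $\mathcal{C}^0$ and the series above can be (repeatedly) integrated term by term on any bounded interval of $[0,\infty)$. (c) If $g$ lies in $\mathcal{C}^r\cap\mathcal{K}^{\max\{p,r\}}$ for some $r\in\mathbb{N}$, then $\Sigma g$ lies in $\mathcal{C}^r$ and the series above can be differentiated term by term up to $r$ times.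
   Context: $\mathbb{N}=\{0,1,2,\ldots\}$, $\mathbb{R}_+=(0,\infty)$, $\Delta f(x)=f(x+1)-f(x)$; $\mathcal{C}^r$ is the set of $r$ times continuously differentiable functions $\mathbb{R}_+\to\mathbb{R}$. For an integer $p\ge -1$, a function $f\colon I\to\mathbb{R}$ on a real interval $I$ is $p$-convex (resp. $p$-concave) if for all $x_0<\cdots<x_{p+1}$ in $I$ the divided difference $f[x_0,\ldots,x_{p+1}]$ is $\ge 0$ (resp. $\le 0$), where $f[x_0,\ldots,x_n]=\sum_{k=0}^n f(x_k)/\prod_{j\ne k}(x_k-x_j)$. $\mathcal{K}^p$ is the set of functions $\mathbb{R}_+\to\mathbb{R}$ that are $p$-convex on some $[a,\infty)$ or $p$-concave on some $[a,\infty)$. $\mathcal{D}^p$ is the set of $g\colon\mathbb{R}_+\to\mathbb{R}$ with $\Delta^pg(n)\to 0$ as $n\to\infty$ over the integers. For $g\in\mathcal{D}^p\cap\mathcal{K}^p$, the function $\Sigma g\colon\mathbb{R}_+\to\mathbb{R}$ is $$\Sigma g(x)=\lim_{n\to\infty}\Big(-g(x)+\sum_{k=1}^{n-1}(g(k)-g(x+k))+\sum_{j=1}^p\binom{x}{j}\Delta^{j-1}g(n)\Big);$$ the limit exists, does not depend on the choice of such $p$, and $\Sigma g$ is the unique solution $f\in\mathcal{K}^p$ of $\Delta f=g$ with $f(1)=0$. *)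

theory Defs
  imports "HOL-Analysis.Analysis"
begin

text \<open>
  Functions defined on the positive half-line are represented by total functions on the reals.
  Everything below depends only on the values at positive arguments, apart from finitely many
  irrelevant members of sequences.
\<close>

definition fwd_diff :: "(real \<Rightarrow> real) \<Rightarrow> real \<Rightarrow> real" where
  "fwd_diff f x = f (x + 1) - f x"

definition divided_diff :: "(real \<Rightarrow> real) \<Rightarrow> (nat \<Rightarrow> real) \<Rightarrow> nat \<Rightarrow> real" where
  "divided_diff f x n = (\<Sum>k\<le>n. f (x k) / (\<Prod>j\<in>{..n} - {k}. x k - x j))"

definition p_convex_on :: "nat \<Rightarrow> real set \<Rightarrow> (real \<Rightarrow> real) \<Rightarrow> bool" where
  "p_convex_on p I f \<longleftrightarrow>
     (\<forall>x. strict_mono_on {..p + 1} x \<and> x ` {..p + 1} \<subseteq> I \<longrightarrow> 0 \<le> divided_diff f x (p + 1))"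

definition p_concave_on :: "nat \<Rightarrow> real set \<Rightarrow> (real \<Rightarrow> real) \<Rightarrow> bool" where
  "p_concave_on p I f \<longleftrightarrow>
     (\<forall>x. strict_mono_on {..p + 1} x \<and> x ` {..p + 1} \<subseteq> I \<longrightarrow> divided_diff f x (p + 1) \<le> 0)"

definition class_K :: "nat \<Rightarrow> (real \<Rightarrow> real) set" where
  "class_K p = {g. (\<exists>a>0. p_convex_on p {a..} g) \<or> (\<exists>a>0. p_concave_on p {a..} g)}"

definition class_D :: "nat \<Rightarrow> (real \<Rightarrow> real) set" where
  "class_D p = {g. (\<lambda>n. (fwd_diff ^^ p) g (real n)) \<longlonglongrightarrow> 0}"

definition class_C :: "nat \<Rightarrow> (real \<Rightarrow> real) set" where
  "class_C r = {f. (\<forall>m<r. (deriv ^^ m) f differentiable_on {0<..}) \<and>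
                   continuous_on {0<..} ((deriv ^^ r) f)}"

definition Sigma_seq :: "nat \<Rightarrow> (real \<Rightarrow> real) \<Rightarrow> nat \<Rightarrow> real \<Rightarrow> real" where
  "Sigma_seq p g n x =
     - g x + (\<Sum>k=1..n-1. g (real k) - g (x + real k))
       + (\<Sum>j=1..p. (x gchoose j) * (fwd_diff ^^ (j - 1)) g (real n))"

text \<open>
  If $g$ lies in both classes for several $p$, the limits coincide,
  so the choice of $p$ is immaterial.
\<close>

definition principal_sum :: "(real \<Rightarrow> real) \<Rightarrow> real \<Rightarrow> real" where
  "principal_sum g x = lim (\<lambda>n. Sigma_seq (SOME p. g \<in> class_D p \<inter> class_K p) g n x)"

definition series_term :: "nat \<Rightarrow> (real \<Rightarrow> real) \<Rightarrow> nat \<Rightarrow> real \<Rightarrow> real" where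
  "series_term p g k x =
     g (x + real k) - (\<Sum>j=0..p. (x gchoose j) * (fwd_diff ^^ j) g (real k))"

definition series_sum :: "nat \<Rightarrow> (real \<Rightarrow> real) \<Rightarrow> real \<Rightarrow> real" where
  "series_sum p g x = (\<Sum>k. series_term p g (Suc k) x)"

text \<open>
  Repeated indefinite integration, with an arbitrary base point at each stage; the head of the
  list is the base point of the outermost integral. The integrals are oriented, so an upper limit
  below the base point is allowed.
\<close>

primrec iterated_integral :: "real list \<Rightarrow> (real \<Rightarrow> real) \<Rightarrow> real \<Rightarrow> real" where
  "iterated_integral [] f = f"
| "iterated_integral (c # cs) f = (\<lambda>x. LBINT t=ereal c..ereal x. iterated_integral cs f t)"

end

theory Submission
  imports Defs "HOL-Computational_Algebra.Polynomial"
begin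

text \<open>
  The sequence defining $\Sigma g$ telescopes, so that all claims concern the series whose $k$-th term
  is the error of the Newton interpolation of $g$ at the nodes $k,\ldots,k+p$, evaluated at $x+k$. If
  $g$ is $p$-convex from some point on, divided differences of $g$ on $p+1$ nodes increase when nodes
  move to the right. The interpolation error is a product of linear factors in $x$, bounded on bounded
  sets, times a divided difference of order $p+1$; one of the factors converts the latter into a
  difference of two divided differences of order $p$. Monotonicity encloses both between
  $\Delta^pg(k-c)/p!$ and $\Delta^pg(k+c)/p!$ for a constant $c$. Since $\Delta^pg(n)$ converges, the
  differences of these bounds form a summable sequence, which gives uniform convergence by the
  criterion of Weierstrass. Termwise integration follows from uniform convergence.

  The same estimate works for derivatives of order $m\le p$. If $g$ is $p$-convex, has vanishing
  limit of $\Delta^pg(n)$ and is differentiable $m$ times, then $g^{(m)}$ is $(p-m)$-convex and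
  $\Delta^{p-m}g^{(m)}(n)$ tends to $0$ (lemma \<open>higher_derivative_convex\<close>). By Rolle's theorem the
  $m$-th derivative of the interpolation error is again an interpolation error, of $g^{(m)}$ at
  $p-m+1$ unknown nodes in $[k,k+p]$, and the argument above applies to any nodes in this interval
  (lemma \<open>remainder_bound\<close>). For $r>p$ the order $p$ is raised to $r$: this changes the series only
  by telescoping series, which converge because $\Delta^jg(n)$ tends to $0$ for all $j\ge p$
  (lemma \<open>remainder_series_uniform_limit\<close>).
\<close>

section \<open>Divided differences on finite sets\<close>

text \<open>
  Indexing by the set of nodes makes the symmetry in the nodes automatic and allows nodes to be
  inserted and exchanged freely.
\<close>

definition dd :: "(real \<Rightarrow> real) \<Rightarrow> real set \<Rightarrow> real" where
  "dd f S = (\<Sum>a\<in>S. f a / (\<Prod>b\<in>S - {a}. a - b))"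

lemma divided_diff_eq_dd:
  assumes "inj_on x {..n}"
  shows "divided_diff f x n = dd f (x ` {..n})"
proof -
  have "(\<Prod>b\<in>x ` {..n} - {x k}. x k - b) = (\<Prod>j\<in>{..n} - {k}. x k - x j)" if "k \<le> n" for k
  proof -
    have eq: "x ` {..n} - {x k} = x ` ({..n} - {k})"
      using assms that by (auto simp: inj_on_def)
    have "inj_on x ({..n} - {k})"
      using assms by (rule inj_on_subset) auto
    then show ?thesis by (simp add: eq prod.reindex)
  qed
  then show ?thesis
    using assms by (simp add: divided_diff_def dd_def sum.reindex)
qed

lemma dd_cong: "(\<And>x. x \<in> S \<Longrightarrow> f x = g x) \<Longrightarrow> dd f S = dd g S"
  by (simp add: dd_def)

lemma dd_add: "dd (\<lambda>x. f x + g x) S = dd f S + dd g S"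
  by (simp add: dd_def add_divide_distrib sum.distrib)

lemma dd_diff: "dd (\<lambda>x. f x - g x) S = dd f S - dd g S"
  by (simp add: dd_def diff_divide_distrib sum_subtractf)

lemma dd_cmult: "dd (\<lambda>x. c * f x) S = c * dd f S"
  by (simp add: dd_def sum_distrib_left)

lemma dd_sum: "dd (\<lambda>x. \<Sum>j\<in>A. f j x) S = (\<Sum>j\<in>A. dd (f j) S)"
  unfolding dd_def sum_divide_distrib by (rule sum.swap)

lemma dd_shift: "dd (\<lambda>x. f (x + c)) S = dd f ((\<lambda>x. x + c) ` S)"
proof -
  have "(\<Prod>b\<in>(\<lambda>x. x + c) ` S - {a + c}. a + c - b) = (\<Prod>b\<in>S - {a}. a - b)" for a
  proof -
    have "(\<lambda>x. x + c) ` S - {a + c} = (\<lambda>x. x + c) ` (S - {a})" by auto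
    then show ?thesis by (simp add: prod.reindex)
  qed
  then show ?thesis by (simp add: dd_def sum.reindex)
qed

lemma dd_insert:
  assumes "finite S" "a \<notin> S"
  shows "dd f (insert a S) = f a / (\<Prod>b\<in>S. a - b) + (\<Sum>c\<in>S. f c / ((c - a) * (\<Prod>b\<in>S - {c}. c - b)))"
proof -
  have "insert a S - {c} = insert a (S - {c})" if "c \<in> S" for c
    using assms that by auto
  with assms show ?thesis
    by (simp add: dd_def)
qed

text \<open>
  Partial fractions: for a node $c$ of $S$ the weights $1/(c-a)$ and $1/(c-b)$ differ by $a-b$ times
  their product. Both monotonicity in the nodes and the link with forward differences rest on this
  identity.
\<close>

lemma dd_recurrence:
  assumes "finite S" "a \<notin> S" "b \<notin> S" "a \<noteq> b"
  shows "(a - b) * dd f (insert a (insert b S)) = dd f (insert a S) - dd f (insert b S)"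
proof -
  define P where "P c = (\<Prod>d\<in>S - {c}. c - d)" for c
  have ins: "insert b S - {c} = insert b (S - {c})" if "c \<in> S" for c
    using assms that by auto
  have "dd f (insert a (insert b S)) =
      f a / ((a - b) * (\<Prod>d\<in>S. a - d)) + (f b / ((b - a) * (\<Prod>d\<in>S. b - d))
      + (\<Sum>c\<in>S. f c / ((c - a) * ((c - b) * P c))))"
    using assms by (simp add: dd_insert ins P_def)
  then have "(a - b) * dd f (insert a (insert b S)) =
      f a / (\<Prod>d\<in>S. a - d) - f b / (\<Prod>d\<in>S. b - d)
      + (a - b) * (\<Sum>c\<in>S. f c / ((c - a) * ((c - b) * P c)))"
    using assms(4) minus_divide_right [of "f b" "\<Prod>d\<in>S. b - d"]
    by (simp add: distrib_left nonzero_mult_div_cancel_left divide_simps) (simp add: algebra_simps)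
  also have "(a - b) * (\<Sum>c\<in>S. f c / ((c - a) * ((c - b) * P c))) =
      (\<Sum>c\<in>S. f c / ((c - a) * P c) - f c / ((c - b) * P c))"
    unfolding sum_distrib_left
  proof (rule sum.cong)
    fix c assume "c \<in> S"
    then have "c - a \<noteq> 0" "c - b \<noteq> 0" using assms by auto
    moreover have "P c \<noteq> 0" using assms(1) by (auto simp: P_def)
    moreover have "(u - v) * (y / (v * (u * z))) = y / (v * z) - y / (u * z)"
      if "u \<noteq> 0" "v \<noteq> 0" "z \<noteq> 0" for u v y z :: real
      using that by (simp add: divide_simps) (simp add: algebra_simps)
    from this [of "c - b" "c - a" "P c" "f c"] calculation
    show "(a - b) * (f c / ((c - a) * ((c - b) * P c))) =
        f c / ((c - a) * P c) - f c / ((c - b) * P c)"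
      by simp
  qed simp
  finally show ?thesis
    using assms by (simp add: dd_insert P_def sum_subtractf)
qed

lemma dd_const:
  assumes "2 \<le> card S"
  shows "dd (\<lambda>x. c) S = 0"
  using assms
proof (induction "card S" arbitrary: S)
  case 0 then show ?case by simp
next
  case (Suc n)
  then obtain a T where T: "S = insert a T" "a \<notin> T" "card T = n"
    by (metis card_Suc_eq)
  moreover have "card T = Suc (n - 1)"
    using Suc T by simp
  ultimately obtain b W where W: "T = insert b W" "b \<notin> W" "card W = n - 1"
    using card_Suc_eq [of T "n - 1"] by auto
  have fin: "finite W"
    using \<open>card T = Suc (n - 1)\<close> W(1) card.infinite [of T] by force
  have "(a - b) * dd (\<lambda>x. c) S = dd (\<lambda>x. c) (insert a W) - dd (\<lambda>x. c) (insert b W)"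
    using dd_recurrence [OF fin, of a b "\<lambda>x. c"] T W by auto
  also have "\<dots> = 0"
  proof (cases "n = 1")
    case True
    then have "W = {}" using W fin by simp
    then show ?thesis by (simp add: dd_def)
  next
    case False
    have n: "card (insert a W) = n" "card (insert b W) = n" "2 \<le> n"
      using T W fin False Suc by auto
    show ?thesis
      using Suc.hyps(1)[of "insert a W"] Suc.hyps(1)[of "insert b W"] n by simp
  qed
  finally show ?case using T W by auto
qed

lemma dd_linear_factor:
  assumes "finite S" "a \<notin> S"
  shows "dd (\<lambda>x. (x - a) * f x) (insert a S) = dd f S"
proof -
  have "(c - a) * f c / ((c - a) * z) = f c / z" if "c \<in> S" for c z
    using that assms by auto
  then show ?thesis using assms by (simp add: dd_insert) (simp add: dd_def)
qed

text \<open>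
  Divided differences with more nodes than the degree requires annihilate polynomials: synthetic
  division by $x-a$ at a node $a$ lowers the degree by one and removes the node $a$.
\<close>

lemma dd_poly:
  assumes "degree p + 2 \<le> card S"
  shows "dd (poly p) S = 0"
  using assms
proof (induction "degree p" arbitrary: p S)
  case 0
  then obtain c where "p = [:c:]" by (metis degree_eq_zeroE)
  then show ?case using 0 dd_const [of S c] by simp
next
  case (Suc n)
  then obtain a where "a \<in> S" by fastforce
  define T where "T = S - {a}"
  have fin: "finite S" using Suc.prems card.infinite by fastforce
  have S: "S = insert a T" "a \<notin> T" "finite T"
    using \<open>a \<in> S\<close> fin by (auto simp: T_def)
  define q where "q = synthetic_div p a"
  have q: "poly p x = poly p a + (x - a) * poly q x" for x
  proof -
    have "poly (p + smult a q) x = poly (pCons (poly p a) q) x"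
      by (simp add: q_def synthetic_div_correct)
    then show ?thesis by (simp add: algebra_simps)
  qed
  have "dd (poly p) S = dd (\<lambda>x. poly p a + (x - a) * poly q x) S"
    by (rule dd_cong) (rule q)
  then have "dd (poly p) S = dd (\<lambda>x. poly p a) S + dd (\<lambda>x. (x - a) * poly q x) S"
    by (simp only: dd_add)
  also have "dd (\<lambda>x. poly p a) S = 0"
    by (rule dd_const) (use Suc in linarith)
  also have "dd (\<lambda>x. (x - a) * poly q x) S = dd (poly q) T"
    unfolding S(1) by (rule dd_linear_factor) (use S in auto)
  also have "\<dots> = 0"
    by (rule Suc.hyps(1)) (use Suc S in \<open>auto simp: q_def degree_synthetic_div\<close>)
  finally show ?case by simp
qed

section \<open>Higher-order convexity\<close>

text \<open>
  Unlike the classes of the theorem, this notion is one-sided; concave functions are treated by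
  changing the sign.
\<close>

definition higher_convex :: "nat \<Rightarrow> real \<Rightarrow> (real \<Rightarrow> real) \<Rightarrow> bool" where
  "higher_convex p a f \<longleftrightarrow> (\<forall>S. finite S \<and> S \<subseteq> {a..} \<and> card S = p + 2 \<longrightarrow> 0 \<le> dd f S)"

lemma enumerate_finite_set:
  fixes S :: "real set"
  assumes "finite S" "card S = n + 1"
  obtains x where "strict_mono_on {..n} x" "x ` {..n} = S" "inj_on x {..n}"
proof
  define x where "x i = sorted_list_of_set S ! i" for i
  have len: "length (sorted_list_of_set S) = n + 1" using assms by simp
  show sm: "strict_mono_on {..n} x"
    unfolding x_def
    using len sorted_wrt_nth_less [OF strict_sorted_list_of_set [of S]]
    by (auto intro!: strict_mono_onI)
  have "{..n} = {0..<length (sorted_list_of_set S)}" using len by auto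
  then show "x ` {..n} = S"
    using assms(1) nth_image [of "length (sorted_list_of_set S)" "sorted_list_of_set S"]
    unfolding x_def by simp
  show "inj_on x {..n}" using sm by (rule strict_mono_on_imp_inj_on)
qed

lemma class_K_imp_higher_convex:
  assumes "g \<in> class_K p"
  obtains a s where "a > 0" "\<bar>s\<bar> = 1" "higher_convex p a (\<lambda>x. s * g x)"
proof -
  have enum: "\<exists>x. strict_mono_on {..p + 1} x \<and> x ` {..p + 1} = S \<and> divided_diff g x (p + 1) = dd g S"
    if "finite S" "card S = p + 2" for S
  proof -
    have "card S = (p + 1) + 1" using that by simp
    from enumerate_finite_set [OF that(1) this] obtain x where
      x: "strict_mono_on {..p + 1} x" "x ` {..p + 1} = S" "inj_on x {..p + 1}" .
    then show ?thesis using divided_diff_eq_dd [OF x(3), of g] by auto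
  qed
  have convex: "0 \<le> dd g S"
    if S: "p_convex_on p {a..} g" "finite S" "S \<subseteq> {a..}" "card S = p + 2" for a S
  proof -
    obtain x where "strict_mono_on {..p + 1} x" "x ` {..p + 1} = S"
      "divided_diff g x (p + 1) = dd g S"
      using enum [OF S(2,4)] by blast
    then show ?thesis
      using S(1,3) unfolding p_convex_on_def by metis
  qed
  have concave: "dd g S \<le> 0"
    if S: "p_concave_on p {a..} g" "finite S" "S \<subseteq> {a..}" "card S = p + 2" for a S
  proof -
    obtain x where "strict_mono_on {..p + 1} x" "x ` {..p + 1} = S"
      "divided_diff g x (p + 1) = dd g S"
      using enum [OF S(2,4)] by blast
    then show ?thesis
      using S(1,3) unfolding p_concave_on_def by metis
  qed
  from assms consider a where "a > 0" "p_convex_on p {a..} g" | a where "a > 0" "p_concave_on p {a..} g"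
    by (auto simp: class_K_def)
  then show thesis
  proof cases
    case 1
    have "higher_convex p a (\<lambda>x. 1 * g x)"
      using convex [OF 1(2)] by (simp add: higher_convex_def)
    then show thesis using that [of a 1] 1 by simp
  next
    case 2
    have "higher_convex p a (\<lambda>x. (-1) * g x)"
      using concave [OF 2(2)] unfolding higher_convex_def dd_cmult by simp
    then show thesis using that [of a "-1"] 2 by simp
  qed
qed

text \<open>
  For a $p$-convex function the divided difference on $p+1$ nodes increases in each node, by the
  recurrence. The nodes in $S$ are moved to the right one after another, each to its final place, and
  $W$ collects the nodes that stay, among them those that have already been moved. The map $\varphi$
  need not preserve the order, but no target may coincide with an old node, since two nodes would
  collide on the way.
\<close>

lemma higher_convex_dd_mono:
  assumes hc: "higher_convex p a f"
    and fin: "finite S" "finite W" and card: "card S + card W = p + 1"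
    and sub: "S \<subseteq> {a..}" "W \<subseteq> {a..}"
    and phi: "inj_on \<phi> S" "\<phi> ` S \<inter> S = {}" "\<And>s. s \<in> S \<Longrightarrow> s < \<phi> s"
    and W: "W \<inter> S = {}" "W \<inter> \<phi> ` S = {}"
  shows "dd f (S \<union> W) \<le> dd f (\<phi> ` S \<union> W)"
  using fin(1,2) card sub phi W
proof (induction S arbitrary: W rule: finite_induct)
  case empty then show ?case by simp
next
  case (insert s S)
  define b where "b = \<phi> s"
  have b: "s < b" "b \<notin> S" "b \<notin> W" "b \<notin> \<phi> ` S" "s \<notin> S" "s \<notin> W"
    using insert by (auto simp: b_def inj_on_def)
  have ab: "a \<le> s" "a \<le> b" using insert b by (auto intro: order_trans less_imp_le)
  have "0 \<le> dd f (insert b (insert s (S \<union> W)))"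
  proof -
    have "card (S \<union> W) = card S + card W"
      using insert by (intro card_Un_disjoint) auto
    moreover have "finite (S \<union> W)" using insert by simp
    ultimately have "card (insert b (insert s (S \<union> W))) = p + 2"
      using insert.prems(2) insert.hyps b by simp
    moreover have "insert b (insert s (S \<union> W)) \<subseteq> {a..}"
      using insert.prems ab by auto
    moreover have "finite (insert b (insert s (S \<union> W)))"
      using insert by simp
    ultimately show ?thesis
      using hc unfolding higher_convex_def by simp
  qed
  then have "0 \<le> (b - s) * dd f (insert b (insert s (S \<union> W)))"
    using b by simp
  also have "\<dots> = dd f (insert b (S \<union> W)) - dd f (insert s (S \<union> W))"
    by (rule dd_recurrence) (use insert b in auto)
  finally have "dd f (insert s S \<union> W) \<le> dd f (S \<union> insert b W)"
    by simp
  also have "\<dots> \<le> dd f (\<phi> ` S \<union> insert b W)"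
  proof (rule insert.IH)
    show "card S + card (insert b W) = p + 1"
      using insert b by simp
    show "insert b W \<subseteq> {a..}" using insert.prems ab by simp
  qed (use insert b in \<open>auto simp: inj_on_def\<close>)
  also have "\<phi> ` S \<union> insert b W = \<phi> ` (insert s S) \<union> W"
    by (auto simp: b_def)
  finally show ?case .
qed

text \<open>
  Any bijection from $S$ onto $T$ moves every node to the right.
\<close>

lemma higher_convex_dd_less:
  assumes hc: "higher_convex p a f" and "finite S" "finite T" "card S = p + 1" "card T = p + 1"
    "S \<subseteq> {a..}" "\<And>s t. s \<in> S \<Longrightarrow> t \<in> T \<Longrightarrow> s < t"
  shows "dd f S \<le> dd f T"
proof -
  obtain \<phi> where \<phi>: "bij_betw \<phi> S T"
    using assms finite_same_card_bij by metis
  then have "\<phi> ` S = T" "inj_on \<phi> S" by (auto simp: bij_betw_def)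
  then show ?thesis
    using higher_convex_dd_mono [OF hc, of S "{}" \<phi>] assms by force
qed

text \<open>
  This is where forward differences enter: up to the factorial they are divided differences at
  equidistant nodes.
\<close>

lemma dd_equidistant:
  "dd f ((\<lambda>i. y + real i) ` {..n}) = (fwd_diff ^^ n) f y / fact n"
proof (induction n arbitrary: y)
  case 0 then show ?case by (simp add: dd_def)
next
  case (Suc n)
  define S where "S = (\<lambda>i. y + real i) ` {1..n}"
  have low: "(\<lambda>i. y + real i) ` {..n} = insert y S"
  proof -
    have "{..n} = insert 0 {1..n}" by auto
    then show ?thesis by (simp add: S_def)
  qed
  have high: "(\<lambda>i. y + 1 + real i) ` {..n} = insert (y + real (Suc n)) S"
  proof -
    have "(\<lambda>i. y + 1 + real i) ` {..n} = (\<lambda>i. y + real i) ` Suc ` {..n}"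
      by (simp add: image_image add.assoc)
    also have "Suc ` {..n} = insert (Suc n) {1..n}"
      by (auto simp: image_Suc_atMost)
    finally show ?thesis by (simp add: S_def)
  qed
  have all: "(\<lambda>i. y + real i) ` {..Suc n} = insert (y + real (Suc n)) (insert y S)"
  proof -
    have "{..Suc n} = insert (Suc n) {..n}" by auto
    then show ?thesis using low by simp
  qed
  have "(y + real (Suc n) - y) * dd f (insert (y + real (Suc n)) (insert y S)) =
      dd f (insert (y + real (Suc n)) S) - dd f (insert y S)"
    by (rule dd_recurrence) (auto simp: S_def)
  also have "\<dots> = (fwd_diff ^^ n) f (y + 1) / fact n - (fwd_diff ^^ n) f y / fact n"
    using Suc [of y] Suc [of "y + 1"] by (simp only: low high)
  also have "\<dots> = (fwd_diff ^^ Suc n) f y / fact n"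
    by (simp add: fwd_diff_def diff_divide_distrib)
  finally have "real (Suc n) * dd f ((\<lambda>i. y + real i) ` {..Suc n}) = (fwd_diff ^^ Suc n) f y / fact n"
    unfolding all by simp
  then show ?case
    by (simp only: fact_Suc) (simp add: divide_simps mult.commute del: of_nat_Suc funpow.simps)
qed

lemma higher_convex_translate:
  assumes "higher_convex p a f" "finite S" "S \<subseteq> {a..}" "card S = p + 1" "0 < h"
    "(\<lambda>x. x + h) ` S \<inter> S = {}"
  shows "dd f S \<le> dd (\<lambda>x. f (x + h)) S"
proof -
  have "dd f (S \<union> {}) \<le> dd f ((\<lambda>x. x + h) ` S \<union> {})"
    by (rule higher_convex_dd_mono [OF assms(1,2)]) (use assms in \<open>simp_all add: inj_on_def\<close>)
  then show ?thesis by (simp add: dd_shift)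
qed

lemma higher_convex_fwd_diff_mono:
  assumes hc: "higher_convex p a f" and y: "a \<le> y" and h: "0 < h" "h < 1"
  shows "(fwd_diff ^^ p) f y \<le> (fwd_diff ^^ p) f (y + h)"
proof -
  define S where "S = (\<lambda>i. y + real i) ` {..p}"
  have "finite S" "S \<subseteq> {a..}" using y by (auto simp: S_def)
  have "card S = p + 1" by (simp add: S_def card_image inj_on_def)
  have "(\<lambda>x. x + h) ` S \<inter> S = {}"
  proof -
    have "y + real i + h \<noteq> y + real j" for i j
    proof
      assume "y + real i + h = y + real j"
      then have "real i < real j" "real j < real (Suc i)" using h by auto
      then have "i < j" "j < Suc i" by (simp_all only: of_nat_less_iff)
      then show False by simp
    qed
    then show ?thesis unfolding S_def by blast
  qed
  then have "dd f S \<le> dd (\<lambda>x. f (x + h)) S"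
    by (rule higher_convex_translate
        [OF hc \<open>finite S\<close> \<open>S \<subseteq> {a..}\<close> \<open>card S = p + 1\<close> h(1)])
  also have "\<dots> = dd f ((\<lambda>i. (y + h) + real i) ` {..p})"
    by (simp add: dd_shift S_def image_image algebra_simps)
  finally show ?thesis
    by (simp add: S_def dd_equidistant divide_le_cancel)
qed

section \<open>Derivatives of higher-order convex functions\<close>

text \<open>
  The divided difference of $(f(x+h)-f(x))/h$ is nonnegative because translating all nodes to the
  right increases divided differences; then $h$ tends to $0$ from the right. A small positive $h$
  keeps the translated nodes apart from the original ones.
\<close>

lemma higher_convex_derivative:
  assumes hc: "higher_convex (Suc p) a f"
    and der: "\<And>x. a \<le> x \<Longrightarrow> (f has_real_derivative f' x) (at x)"
  shows "higher_convex p a f'"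
  unfolding higher_convex_def
proof (intro allI impI, elim conjE)
  fix S :: "real set"
  assume S: "finite S" "S \<subseteq> {a..}" "card S = p + 2"
  have "((\<lambda>h. dd (\<lambda>x. (f (x + h) - f x) / h) S) \<longlongrightarrow> dd f' S) (at_right 0)"
    unfolding dd_def
  proof (intro tendsto_sum tendsto_divide tendsto_const)
    fix x assume "x \<in> S"
    then have "((\<lambda>h. (f (x + h) - f x) / h) \<longlongrightarrow> f' x) (at 0)"
      using der [of x] S by (auto simp: DERIV_def)
    then show "((\<lambda>h. (f (x + h) - f x) / h) \<longlongrightarrow> f' x) (at_right 0)"
      by (rule filterlim_mono) (auto simp: at_le)
  qed (use S in auto)
  moreover have "\<forall>\<^sub>F h in at_right 0. 0 \<le> dd (\<lambda>x. (f (x + h) - f x) / h) S"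
  proof -
    have "\<forall>\<^sub>F h in at_right 0. \<forall>s\<in>S. \<forall>t\<in>S. h \<noteq> t - s"
      using S(1) by (intro eventually_ball_finite ballI eventually_neq_at_within)
    moreover have "\<forall>\<^sub>F h in at_right (0::real). 0 < h"
      by (rule eventually_at_right_less)
    ultimately show ?thesis
    proof eventually_elim
      case (elim h)
      have "(\<lambda>x. x + h) ` S \<inter> S = {}"
        using elim(1) by (force simp: algebra_simps)
      then have "dd f S \<le> dd (\<lambda>x. f (x + h)) S"
        using S elim(2) by (intro higher_convex_translate [OF hc]) auto
      then have "0 \<le> (1 / h) * dd (\<lambda>x. f (x + h) - f x) S"
        using elim(2) by (simp add: dd_diff)
      then show ?case
        by (simp only: dd_cmult [symmetric]) simp
    qed
  qed
  ultimately show "0 \<le> dd f' S"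
    by (rule tendsto_lowerbound) simp
qed

lemma fwd_diff_has_derivative:
  assumes "\<And>x. 0 < x \<Longrightarrow> (f has_real_derivative f' x) (at x)" "0 < x"
  shows "((fwd_diff ^^ n) f has_real_derivative (fwd_diff ^^ n) f' x) (at x)"
  using assms(2)
proof (induction n arbitrary: x)
  case 0 then show ?case using assms by simp
next
  case (Suc n)
  have "((\<lambda>x. (fwd_diff ^^ n) f (x + 1) - (fwd_diff ^^ n) f x) has_real_derivative
      (fwd_diff ^^ n) f' (x + 1) - (fwd_diff ^^ n) f' x) (at x)"
    using Suc.IH [of x] Suc.IH [of "x + 1"] Suc.prems by (intro DERIV_diff) (simp_all add: DERIV_shift)
  then show ?case by (simp add: fwd_diff_def [abs_def])
qed

text \<open>
  By the mean value theorem $\Delta^{p+1}f(y)=\Delta^pf'(z)$ for some $z\in(y,y+1)$. Since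
  $\Delta^pf'$ increases, its values at the integers lie between consecutive values of
  $\Delta^{p+1}f$.
\<close>

lemma fwd_diff_derivative_tendsto_0:
  assumes hc: "higher_convex (Suc p) a f"
    and a: "0 < a"
    and der: "\<And>x. 0 < x \<Longrightarrow> (f has_real_derivative f' x) (at x)"
    and lim: "(\<lambda>n. (fwd_diff ^^ Suc p) f (real n)) \<longlonglongrightarrow> 0"
  shows "(\<lambda>n. (fwd_diff ^^ p) f' (real n)) \<longlonglongrightarrow> 0"
proof -
  have hc': "higher_convex p a f'"
    using higher_convex_derivative [OF hc, of f'] der a by force
  have between: "(fwd_diff ^^ p) f' y \<le> (fwd_diff ^^ Suc p) f y \<and>
      (fwd_diff ^^ Suc p) f y \<le> (fwd_diff ^^ p) f' (y + 1)" if "a \<le> y" for y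
  proof -
    have "\<exists>z>y. z < y + 1 \<and> (fwd_diff ^^ p) f (y + 1) - (fwd_diff ^^ p) f y =
        (y + 1 - y) * (fwd_diff ^^ p) f' z"
      using that a by (intro MVT2) (auto intro: fwd_diff_has_derivative der)
    then obtain z where z: "y < z" "z < y + 1"
      "(fwd_diff ^^ Suc p) f y = (fwd_diff ^^ p) f' z"
      by (auto simp: fwd_diff_def)
    have "(fwd_diff ^^ p) f' y \<le> (fwd_diff ^^ p) f' z"
      using higher_convex_fwd_diff_mono [OF hc' that, of "z - y"] z by simp
    moreover have "(fwd_diff ^^ p) f' z \<le> (fwd_diff ^^ p) f' (y + 1)"
      using higher_convex_fwd_diff_mono [OF hc', of z "y + 1 - z"] z that by simp
    ultimately show ?thesis using z by simp
  qed
  have "(\<lambda>n. (fwd_diff ^^ p) f' (real (Suc n))) \<longlonglongrightarrow> 0"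
  proof (rule tendsto_sandwich)
    show "(\<lambda>n. (fwd_diff ^^ Suc p) f (real n)) \<longlonglongrightarrow> 0" by (rule lim)
    show "(\<lambda>n. (fwd_diff ^^ Suc p) f (real (Suc n))) \<longlonglongrightarrow> 0" using lim by (rule LIMSEQ_Suc)
    have ev: "\<forall>\<^sub>F n in sequentially. a \<le> real n"
      by (meson eventually_sequentiallyI real_nat_ceiling_ge order_trans of_nat_mono)
    show "\<forall>\<^sub>F n in sequentially. (fwd_diff ^^ Suc p) f (real n) \<le> (fwd_diff ^^ p) f' (real (Suc n))"
      using ev
    proof eventually_elim
      case (elim n) then show ?case using between [of "real n"] by (simp add: add.commute)
    qed
    show "\<forall>\<^sub>F n in sequentially. (fwd_diff ^^ p) f' (real (Suc n)) \<le> (fwd_diff ^^ Suc p) f (real (Suc n))"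
      using ev
    proof eventually_elim
      case (elim n) then show ?case using between [of "real (Suc n)"] by simp
    qed
  qed
  then show ?thesis by (rule LIMSEQ_imp_Suc)
qed

text \<open>
  Each differentiation lowers both orders, that of convexity and that of the vanishing difference, by
  one. The sequence $G$ lists the successive derivatives of $G_0$.
\<close>

lemma higher_derivative_convex:
  assumes "\<And>i x. i < m \<Longrightarrow> 0 < x \<Longrightarrow> (G i has_real_derivative G (Suc i) x) (at x)"
    and "0 < a" "m \<le> p" "higher_convex p a (G 0)"
    and "(\<lambda>n. (fwd_diff ^^ p) (G 0) (real n)) \<longlonglongrightarrow> 0"
  shows "higher_convex (p - m) a (G m) \<and> (\<lambda>n. (fwd_diff ^^ (p - m)) (G m) (real n)) \<longlonglongrightarrow> 0"
  using assms(1,3)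
proof (induction m)
  case 0 then show ?case using assms by simp
next
  case (Suc m)
  have p: "p - m = Suc (p - Suc m)" using Suc.prems by simp
  have IH: "higher_convex (Suc (p - Suc m)) a (G m)"
    "(\<lambda>n. (fwd_diff ^^ Suc (p - Suc m)) (G m) (real n)) \<longlonglongrightarrow> 0"
    using Suc.IH Suc.prems unfolding p by auto
  have der: "(G m has_real_derivative G (Suc m) x) (at x)" if "0 < x" for x
    using Suc.prems that by simp
  show ?case
    using fwd_diff_derivative_tendsto_0 [OF IH(1) assms(2) der IH(2)]
      higher_convex_derivative [OF IH(1), of "G (Suc m)"] der assms(2) by force
qed

section \<open>Zeros of derivatives\<close>

text \<open>
  Rolle's theorem between consecutive zeros; the new zeros are distinct because the open intervals
  between neighbours are disjoint.
\<close>

lemma zeros_of_derivative: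
  fixes f :: "real \<Rightarrow> real"
  assumes "finite X" "card X = Suc n" "X \<subseteq> {u..v}" "\<And>x. x \<in> X \<Longrightarrow> f x = 0"
    and der: "\<And>x. x \<in> {u..v} \<Longrightarrow> (f has_real_derivative f' x) (at x)"
  obtains Y where "finite Y" "card Y = n" "Y \<subseteq> {u..v}" "\<And>y. y \<in> Y \<Longrightarrow> f' y = 0"
proof -
  obtain x where x: "strict_mono_on {..n} x" "x ` {..n} = X" "inj_on x {..n}"
    using enumerate_finite_set [OF assms(1), of n] assms(2) by auto
  have in_X: "x i \<in> X" if "i \<le> n" for i using x(2) that by auto
  have "\<exists>z. x i < z \<and> z < x (Suc i) \<and> f' z = 0" if "i < n" for i
  proof -
    have lt: "x i < x (Suc i)" using x(1) that by (auto simp: strict_mono_on_def)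
    have sub: "{x i..x (Suc i)} \<subseteq> {u..v}"
      using in_X [of i] in_X [of "Suc i"] that assms(3) by force
    have "\<exists>z>x i. z < x (Suc i) \<and> f (x (Suc i)) - f (x i) = (x (Suc i) - x i) * f' z"
      using lt sub by (intro MVT2 der) auto
    then show ?thesis
      using assms(4) [OF in_X [of i]] assms(4) [OF in_X [of "Suc i"]] that lt by auto
  qed
  then obtain z where z: "\<And>i. i < n \<Longrightarrow> x i < z i" "\<And>i. i < n \<Longrightarrow> z i < x (Suc i)"
    "\<And>i. i < n \<Longrightarrow> f' (z i) = 0" by metis
  have less: "z i < z j" if "i < j" "j < n" for i j
  proof -
    have "x (Suc i) \<le> x j"
      using x(1) that by (intro strict_mono_on_leD [OF x(1)]) auto
    then show ?thesis using z(1)[of j] z(2)[of i] that by simp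
  qed
  have "inj_on z {..<n}"
    by (rule inj_onI) (metis less lessThan_iff linorder_neqE_nat order_less_irrefl)
  moreover have "z ` {..<n} \<subseteq> {u..v}"
  proof clarify
    fix i assume "i < n"
    then show "z i \<in> {u..v}"
      using z(1,2)[of i] in_X [of i] in_X [of "Suc i"] assms(3) by force
  qed
  ultimately show thesis
    using that [of "z ` {..<n}"] z(3) by (auto simp: card_image)
qed

lemma zeros_of_higher_derivative:
  fixes F :: "nat \<Rightarrow> real \<Rightarrow> real"
  assumes "finite X" "card X = n + m" "X \<subseteq> {u..v}" "\<And>x. x \<in> X \<Longrightarrow> F 0 x = 0"
    and "\<And>i x. i < m \<Longrightarrow> x \<in> {u..v} \<Longrightarrow> (F i has_real_derivative F (Suc i) x) (at x)"
  shows "\<exists>Y. finite Y \<and> card Y = n \<and> Y \<subseteq> {u..v} \<and> (\<forall>y\<in>Y. F m y = 0)"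
  using assms(2,5)
proof (induction m arbitrary: n)
  case 0 then show ?case using assms(1,3,4) by auto
next
  case (Suc m)
  obtain Y where Y: "finite Y" "card Y = Suc n" "Y \<subseteq> {u..v}" "\<And>y. y \<in> Y \<Longrightarrow> F m y = 0"
    using Suc.IH [of "Suc n"] Suc.prems by auto
  obtain Z where "finite Z" "card Z = n" "Z \<subseteq> {u..v}" "\<And>y. y \<in> Z \<Longrightarrow> F (Suc m) y = 0"
    by (rule zeros_of_derivative [OF Y, where f' = "F (Suc m)"]) (use Suc.prems(2) in auto)
  then show ?case by blast
qed

section \<open>Newton interpolation and its remainder\<close>

text \<open>
  The binomial coefficient as a polynomial in its upper argument, so that its derivatives and their
  degrees are available.
\<close>

definition binom_poly :: "nat \<Rightarrow> real poly" where
  "binom_poly j = smult (1 / fact j) (\<Prod>i<j. [:- real i, 1:])"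

lemma poly_binom_poly: "poly (binom_poly j) x = x gchoose j"
  by (simp add: binom_poly_def poly_prod gbinomial_prod_rev atLeast0LessThan algebra_simps)

lemma degree_binom_poly: "degree (binom_poly j) \<le> j"
proof -
  have "degree (\<Prod>i<j. [:- real i, 1:]) \<le> sum (degree \<circ> (\<lambda>i. [:- real i, 1:])) {..<j}"
    by (rule degree_prod_sum_le) simp
  then show ?thesis
    unfolding binom_poly_def by (simp add: o_def)
qed

definition binom_deriv :: "nat \<Rightarrow> nat \<Rightarrow> real \<Rightarrow> real" where
  "binom_deriv m j = poly ((pderiv ^^ m) (binom_poly j))"

lemma binom_deriv_0 [simp]: "binom_deriv 0 j x = x gchoose j"
  by (simp add: binom_deriv_def poly_binom_poly)

lemma binom_deriv_has_derivative:
  "(binom_deriv m j has_real_derivative binom_deriv (Suc m) j x) (at x)"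
  unfolding binom_deriv_def by (simp add: poly_DERIV)

lemma dd_binom_deriv:
  assumes "j - m + 2 \<le> card S"
  shows "dd (binom_deriv m j) S = 0"
proof -
  have "degree ((pderiv ^^ m) (binom_poly j)) \<le> j - m"
    using degree_binom_poly [of j] by (simp add: degree_higher_pderiv diff_le_mono)
  then show ?thesis
    unfolding binom_deriv_def by (intro dd_poly) (use assms in linarith)
qed

text \<open>
  With $m=0$ this is the $k$-th term of the series for $G_0$, the error at $x+k$ of the Newton
  interpolation of $G_0$ at $k,\ldots,k+p$. If $G$ lists the derivatives of $G_0$, then $m$ is the
  order of differentiation in $x$.
\<close>

definition remainder :: "(nat \<Rightarrow> real \<Rightarrow> real) \<Rightarrow> nat \<Rightarrow> nat \<Rightarrow> nat \<Rightarrow> real \<Rightarrow> real" where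
  "remainder G p m k x =
     G m (x + real k) - (\<Sum>j\<le>p. binom_deriv m j x * (fwd_diff ^^ j) (G 0) (real k))"

lemma remainder_has_derivative:
  assumes "\<And>x. 0 < x \<Longrightarrow> (G m has_real_derivative G (Suc m) x) (at x)" "0 < x + real k"
  shows "(remainder G p m k has_real_derivative remainder G p (Suc m) k x) (at x)"
proof -
  have "((\<lambda>x. G m (x + real k)) has_real_derivative G (Suc m) (x + real k)) (at x)"
    using assms by (simp only: DERIV_shift [symmetric])
  then show ?thesis
    unfolding remainder_def [abs_def]
    by (intro DERIV_diff DERIV_sum DERIV_cmult_right binom_deriv_has_derivative)
qed

text \<open>
  Pascal's rule, applied to $f$ and $\Delta f$ at once; hence the induction over all functions.
\<close>

lemma newton_forward:
  fixes f :: "real \<Rightarrow> real"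
  shows "f (y + real n) = (\<Sum>j\<le>n. real (n choose j) * (fwd_diff ^^ j) f y)"
proof (induction n arbitrary: f)
  case 0 then show ?case by simp
next
  case (Suc n)
  define D where "D j = (fwd_diff ^^ j) f y" for j
  have "f (y + real (Suc n)) = f (y + real n) + fwd_diff f (y + real n)"
    by (simp add: fwd_diff_def add.commute add.left_commute)
  also have "\<dots> = (\<Sum>j\<le>n. real (n choose j) * D j) + (\<Sum>j\<le>n. real (n choose j) * D (Suc j))"
    using Suc [of f] Suc [of "fwd_diff f"] by (simp add: D_def funpow_swap1)
  also have "(\<Sum>j\<le>n. real (n choose j) * D j) = (\<Sum>j\<le>Suc n. real (n choose j) * D j)"
    by simp
  also have "\<dots> = D 0 + (\<Sum>j\<le>n. real (n choose Suc j) * D (Suc j))"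
    unfolding sum.atMost_Suc_shift by simp
  also have "\<dots> + (\<Sum>j\<le>n. real (n choose j) * D (Suc j)) =
      D 0 + (\<Sum>j\<le>n. real (Suc n choose Suc j) * D (Suc j))"
    by (simp add: sum.distrib [symmetric] algebra_simps)
  also have "\<dots> = (\<Sum>j\<le>Suc n. real (Suc n choose j) * D j)"
    unfolding sum.atMost_Suc_shift by simp
  finally show ?case by (simp add: D_def)
qed

lemma remainder_at_nodes:
  assumes "n \<le> p"
  shows "remainder G p 0 k (real n) = 0"
proof -
  have "(\<Sum>j\<le>p. (real n gchoose j) * (fwd_diff ^^ j) (G 0) (real k)) =
      (\<Sum>j\<le>n. real (n choose j) * (fwd_diff ^^ j) (G 0) (real k))"
    using assms by (intro sum.mono_neutral_cong_right)
      (auto simp: binomial_gbinomial [symmetric] not_le)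
  also have "\<dots> = G 0 (real n + real k)"
    using newton_forward [of "G 0" "real k" n] by (simp add: add.commute)
  finally show ?thesis by (simp add: remainder_def)
qed

text \<open>
  This estimate carries the whole theorem. The undifferentiated remainder vanishes at $0,\ldots,p$,
  so by Rolle its $m$-th derivative $e$ vanishes on a set $X$ of $q+1$ points of $[0,p]$, where
  $q=p-m$. Moreover $e(x)=G_m(x+k)$ up to a polynomial of degree at most $q$, which divided differences
  on $q+2$ nodes do not see. Hence $e(x)$ is the product of the $x-y$ over $y\in X$ times a divided
  difference of $G_m$ of order $q+1$. One factor $x-b$ turns it into a difference of two divided
  differences of order $q$. All their nodes lie between $n+q$ and $n+q+1+L$, so both are between the
  values at the equidistant nodes starting at $n$ and those starting at $n+q+1+L$. The two outer values
  are those of one sequence at the fixed distance $q+1+L$, which makes the bounds summable.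
\<close>

lemma remainder_bound:
  assumes der: "\<And>i x. i < m \<Longrightarrow> 0 < x \<Longrightarrow> (G i has_real_derivative G (Suc i) x) (at x)"
    and hc: "higher_convex q a (G m)" and p: "p = q + m"
    and n: "a \<le> real n" and x: "0 \<le> x" "x \<le> M" and M: "real p \<le> M" "M < real L"
  shows "\<bar>remainder G p m (n + q + 1) x\<bar> \<le>
      M ^ q / fact q * ((fwd_diff ^^ q) (G m) (real (n + (q + 1 + L))) - (fwd_diff ^^ q) (G m) (real n))"
proof -
  have "0 \<le> M" using x by simp
  \<comment> \<open>This offset puts the $q+1$ equidistant nodes starting at $n$ strictly to the left of $k$, while
    all nodes $y+k$ with $y\<in>[0,M]$ lie strictly to the left of $k+L$.\<close>
  define k where "k = n + q + 1"
  define A where "A = dd (G m) ((\<lambda>i. real n + real i) ` {..q})"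
  define B where "B = dd (G m) ((\<lambda>i. real (k + L) + real i) ` {..q})"
  define h where "h y = G m (y + real k)" for y
  have between: "A \<le> dd h S \<and> dd h S \<le> B" if S: "finite S" "card S = q + 1" "S \<subseteq> {0..M}" for S
  proof -
    let ?S = "(\<lambda>y. y + real k) ` S"
    have fin: "finite ?S" and card: "card ?S = q + 1"
      using S by (simp_all add: card_image)
    have sub: "?S \<subseteq> {real k..M + real k}" using S by auto
    have cards: "card ((\<lambda>i. c + real i) ` {..q}) = q + 1" for c
      by (simp add: card_image inj_on_def)
    have "A \<le> dd (G m) ?S"
      unfolding A_def
    proof (rule higher_convex_dd_less [OF hc])
      fix s t assume "s \<in> (\<lambda>i. real n + real i) ` {..q}" "t \<in> ?S"
      then have "s \<le> real n + real q" "real k \<le> t" using sub by auto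
      then show "s < t" by (simp add: k_def)
    qed (use fin card cards n sub in \<open>auto simp: k_def\<close>)
    moreover have "dd (G m) ?S \<le> B"
      unfolding B_def
    proof (rule higher_convex_dd_less [OF hc])
      fix s t assume "s \<in> ?S" "t \<in> (\<lambda>i. real (k + L) + real i) ` {..q}"
      then have "s \<le> M + real k" "real (k + L) \<le> t" using sub by auto
      then show "s < t" using M by simp
    qed (use fin card cards n S in \<open>auto simp: k_def\<close>)
    moreover have "dd h S = dd (G m) ?S"
      unfolding h_def by (rule dd_shift)
    ultimately show ?thesis by simp
  qed
  have "\<exists>X. finite X \<and> card X = q + 1 \<and> X \<subseteq> {0..real p} \<and> (\<forall>y\<in>X. remainder G p m k y = 0)"
  proof (rule zeros_of_higher_derivative
      [where X = "real ` {..p}" and F = "\<lambda>i. remainder G p i k"])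
    show "finite (real ` {..p})" "card (real ` {..p}) = q + 1 + m" "real ` {..p} \<subseteq> {0..real p}"
      using p by (auto simp: card_image)
    show "remainder G p 0 k x = 0" if "x \<in> real ` {..p}" for x
      using that by (auto intro: remainder_at_nodes)
    show "(remainder G p i k has_real_derivative remainder G p (Suc i) k x) (at x)"
      if "i < m" "x \<in> {0..real p}" for i x
      using that der by (intro remainder_has_derivative) (auto simp: k_def)
  qed
  then obtain X where X: "finite X" "card X = q + 1" "X \<subseteq> {0..real p}"
    and zero: "\<And>y. y \<in> X \<Longrightarrow> remainder G p m k y = 0" by blast
  have XM: "X \<subseteq> {0..M}" using X(3) M by auto
  have "A \<le> B" using between [OF X(1,2) XM] by simp
  have "\<bar>remainder G p m k x\<bar> \<le> M ^ q * (B - A)"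
  proof (cases "x \<in> X")
    case True
    then show ?thesis using zero \<open>0 \<le> M\<close> \<open>A \<le> B\<close> by simp
  next
    case False
    obtain b where "b \<in> X" using X(2) by fastforce
    define W where "W = X - {b}"
    have W: "X = insert b W" "b \<notin> W" "finite W" "card W = q"
      using X \<open>b \<in> X\<close> by (auto simp: W_def)
    \<comment> \<open>The node $b$ is the one whose factor $x-b$ lowers the order; $W$ keeps the other $q$ factors.\<close>
    have "x \<noteq> b" "x \<notin> W" using False W by auto
    have "dd (remainder G p m k) (insert x X) = remainder G p m k x / (\<Prod>y\<in>X. x - y)"
      using dd_insert [OF X(1) False, of "remainder G p m k"] zero by simp
    moreover have "dd (remainder G p m k) (insert x X) = dd h (insert x X)"
    proof -
      have "dd (\<lambda>y. \<Sum>j\<le>p. binom_deriv m j y * (fwd_diff ^^ j) (G 0) (real k)) (insert x X) = 0"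
      proof -
        have "dd (\<lambda>y. (fwd_diff ^^ j) (G 0) (real k) * binom_deriv m j y) (insert x X) = 0" if "j \<le> p" for j
          unfolding dd_cmult using that X False p by (simp add: dd_binom_deriv)
        then show ?thesis unfolding dd_sum by (simp add: mult.commute)
      qed
      then show ?thesis
        unfolding remainder_def [abs_def] dd_diff h_def by simp
    qed
    moreover have "(\<Prod>y\<in>X. x - y) \<noteq> 0" using X(1) False by auto
    ultimately have "remainder G p m k x = (\<Prod>y\<in>X. x - y) * dd h (insert x X)"
      by (simp add: field_simps)
    also have "\<dots> = (\<Prod>y\<in>W. x - y) * ((x - b) * dd h (insert x (insert b W)))"
      using W by simp
    also have "(x - b) * dd h (insert x (insert b W)) = dd h (insert x W) - dd h X"
      using dd_recurrence [OF W(3) \<open>x \<notin> W\<close> W(2) \<open>x \<noteq> b\<close>] W(1) by simp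
    finally have eq: "remainder G p m k x = (\<Prod>y\<in>W. x - y) * (dd h (insert x W) - dd h X)" .
    have "A \<le> dd h (insert x W) \<and> dd h (insert x W) \<le> B"
      using W x XM \<open>x \<notin> W\<close> by (intro between) auto
    then have "\<bar>dd h (insert x W) - dd h X\<bar> \<le> B - A"
      using between [OF X(1,2) XM] by linarith
    moreover have "\<bar>\<Prod>y\<in>W. x - y\<bar> \<le> M ^ q"
    proof -
      have "(\<Prod>y\<in>W. \<bar>x - y\<bar>) \<le> (\<Prod>y\<in>W. M)"
      proof (rule prod_mono)
        fix y assume "y \<in> W"
        then have "0 \<le> y" "y \<le> M" using XM W by auto
        then show "0 \<le> \<bar>x - y\<bar> \<and> \<bar>x - y\<bar> \<le> M" using x by auto
      qed
      then show ?thesis using W by (simp add: abs_prod)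
    qed
    ultimately show ?thesis
      unfolding eq abs_mult using \<open>0 \<le> M\<close> by (intro mult_mono) auto
  qed
  also have "\<dots> = M ^ q / fact q * ((fwd_diff ^^ q) (G m) (real (n + (q + 1 + L))) - (fwd_diff ^^ q) (G m) (real n))"
    unfolding A_def B_def dd_equidistant by (simp add: k_def diff_divide_distrib algebra_simps)
  finally show ?thesis by (simp add: k_def)
qed

section \<open>Uniform convergence of the remainder series\<close>

text \<open>
  The gap $c$ splits into $c$ telescoping series.
\<close>

lemma summable_gap_difference:
  fixes u :: "nat \<Rightarrow> real"
  assumes "u \<longlonglongrightarrow> l"
  shows "summable (\<lambda>n. u (n + c) - u n)"
proof -
  have "summable (\<lambda>n. u (Suc (n + i)) - u (n + i))" for i
    using telescope_summable [OF LIMSEQ_ignore_initial_segment [OF assms, of i]] by simp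
  then have "summable (\<lambda>n. \<Sum>i<c. u (Suc (n + i)) - u (n + i))"
    by (intro summable_sum)
  moreover have "(\<Sum>i<c. u (Suc (n + i)) - u (n + i)) = u (n + c) - u n" for n
    using sum_lessThan_telescope [of "\<lambda>i. u (n + i)" c] by simp
  ultimately show ?thesis by simp
qed

lemma fwd_diff_cmult: "(fwd_diff ^^ j) (\<lambda>x. c * f x) y = c * (fwd_diff ^^ j) f y"
  by (induction j arbitrary: y) (simp_all add: fwd_diff_def algebra_simps)

lemma remainder_cmult: "remainder (\<lambda>i x. c * G i x) p m k x = c * remainder G p m k x"
  by (simp add: remainder_def fwd_diff_cmult sum_distrib_left algebra_simps)

text \<open>
  Weierstrass' criterion; the majorant from \<open>remainder_bound\<close> is available once $k$ is so large that
  all nodes lie where $G_0$ is $p$-convex or $p$-concave.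
\<close>

lemma remainder_series_uniform_limit_same_order:
  assumes der: "\<And>i x. i < m \<Longrightarrow> 0 < x \<Longrightarrow> (G i has_real_derivative G (Suc i) x) (at x)"
    and G: "G 0 \<in> class_D p \<inter> class_K p" and m: "m \<le> p"
    and B: "bounded B" "B \<subseteq> {0..}"
  shows "uniform_limit B (\<lambda>n x. \<Sum>i<n. remainder G p m (Suc i) x)
    (\<lambda>x. \<Sum>i. remainder G p m (Suc i) x) sequentially"
proof -
  obtain a s where a: "a > 0" "\<bar>s\<bar> = (1::real)" and hc0: "higher_convex p a (\<lambda>x. s * G 0 x)"
    using G by (auto elim: class_K_imp_higher_convex)
  define H where "H i x = s * G i x" for i x
  define q where "q = p - m"
  have derH: "(H i has_real_derivative H (Suc i) x) (at x)" if "i < m" "0 < x" for i x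
    unfolding H_def [abs_def] by (intro DERIV_cmult der that)
  have lim0: "(\<lambda>n. (fwd_diff ^^ p) (H 0) (real n)) \<longlonglongrightarrow> 0"
    using G tendsto_mult_left [of "\<lambda>n. (fwd_diff ^^ p) (G 0) (real n)" 0 sequentially s]
    unfolding class_D_def H_def fwd_diff_cmult by simp
  have hc: "higher_convex q a (H m)" and lim: "(\<lambda>n. (fwd_diff ^^ q) (H m) (real n)) \<longlonglongrightarrow> 0"
    using higher_derivative_convex [OF derH a(1) m _ lim0] hc0
    unfolding q_def H_def by auto
  obtain b where b: "\<And>x. x \<in> B \<Longrightarrow> \<bar>x\<bar> \<le> b"
    using B(1) by (auto simp: bounded_real)
  define M where "M = max b (real p)"
  obtain L where L: "M < real L" using reals_Archimedean2 by blast
  define maj where "maj n = M ^ q / fact q *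
    ((fwd_diff ^^ q) (H m) (real (n + (q + 1 + L))) - (fwd_diff ^^ q) (H m) (real n))" for n
  have "summable maj"
    unfolding maj_def by (intro summable_mult summable_gap_difference [OF lim])
  then have "summable (\<lambda>i. maj (i - q))"
    using summable_iff_shift [of "\<lambda>i. maj (i - q)" q] by simp
  moreover have "\<forall>\<^sub>F i in sequentially. \<forall>x\<in>B. norm (remainder G p m (Suc i) x) \<le> maj (i - q)"
  proof (rule eventually_sequentiallyI)
    fix i assume i: "nat \<lceil>a\<rceil> + q \<le> i"
    show "\<forall>x\<in>B. norm (remainder G p m (Suc i) x) \<le> maj (i - q)"
    proof
      fix x assume "x \<in> B"
      have "a \<le> real (i - q)"
      proof -
        have "nat \<lceil>a\<rceil> \<le> i - q" using i by (rule add_le_imp_le_diff)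
        then show ?thesis by (meson of_nat_mono order_trans real_nat_ceiling_ge)
      qed
      moreover have "0 \<le> x" "x \<le> M" using B(2) b \<open>x \<in> B\<close> by (force simp: M_def)+
      ultimately have "\<bar>remainder H p m ((i - q) + q + 1) x\<bar> \<le> maj (i - q)"
        unfolding maj_def
        by (intro remainder_bound [OF derH hc]) (use m L in \<open>auto simp: q_def M_def\<close>)
      then show "norm (remainder G p m (Suc i) x) \<le> maj (i - q)"
        using i a(2) unfolding H_def [abs_def] remainder_cmult by (simp add: abs_mult)
    qed
  qed
  ultimately show ?thesis by (rule Weierstrass_m_test_ev [rotated])
qed

lemma fwd_diff_tendsto_0:
  assumes "g \<in> class_D p" "p \<le> j"
  shows "(\<lambda>n. (fwd_diff ^^ j) g (real n)) \<longlonglongrightarrow> 0"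
  using assms(2)
proof (induction j rule: dec_induct)
  case base then show ?case using assms(1) by (simp add: class_D_def)
next
  case (step j)
  have "(\<lambda>n. (fwd_diff ^^ j) g (real (Suc n)) - (fwd_diff ^^ j) g (real n)) \<longlonglongrightarrow> 0 - 0"
    by (intro tendsto_diff LIMSEQ_Suc step.IH)
  then show ?case by (simp add: fwd_diff_def [of "(fwd_diff ^^ j) g"] add.commute)
qed

lemma uniform_limit_of_constants:
  fixes v :: "nat \<Rightarrow> real"
  assumes "v \<longlonglongrightarrow> l"
  shows "uniform_limit B (\<lambda>n x. v n) (\<lambda>x. l) sequentially"
  using assms unfolding uniform_limit_iff tendsto_iff by (auto elim: eventually_mono)

lemma uniform_limit_finite_sum:
  fixes f :: "'i \<Rightarrow> nat \<Rightarrow> 'a \<Rightarrow> real"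
  assumes "\<And>j. j \<in> J \<Longrightarrow> uniform_limit B (f j) (l j) sequentially"
  shows "uniform_limit B (\<lambda>n x. \<Sum>j\<in>J. f j n x) (\<lambda>x. \<Sum>j\<in>J. l j x) sequentially"
  using assms
proof (induction J rule: infinite_finite_induct)
  case (insert j J)
  have "uniform_limit B (\<lambda>n x. f j n x + (\<Sum>j\<in>J. f j n x)) (\<lambda>x. l j x + (\<Sum>j\<in>J. l j x)) sequentially"
    by (rule uniform_limit_add) (use insert in auto)
  then show ?case using insert.hyps by simp
qed (simp_all only: sum.infinite sum.empty uniform_limit_const not_False_eq_True)

lemma binom_deriv_continuous: "continuous_on B (binom_deriv m j)"
  unfolding binom_deriv_def by (intro continuous_intros)

lemma bounded_binom_deriv:
  assumes "bounded B"
  shows "bounded (binom_deriv m j ` B)"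
proof (rule bounded_subset)
  show "bounded (binom_deriv m j ` closure B)"
    using assms by (intro compact_imp_bounded compact_continuous_image binom_deriv_continuous)
      (simp add: compact_closure)
  show "binom_deriv m j ` B \<subseteq> binom_deriv m j ` closure B"
    using closure_subset by blast
qed

lemma remainder_order:
  assumes "p \<le> P"
  shows "remainder G p m k x = remainder G P m k x
    + (\<Sum>j\<in>{p<..P}. binom_deriv m j x * (fwd_diff ^^ j) (G 0) (real k))"
proof -
  have "{..P} = {..p} \<union> {p<..P}" using assms by auto
  then show ?thesis
    unfolding remainder_def by (simp add: sum.union_disjoint ivl_disj_int)
qed

text \<open>
  A series of lower order $p$ differs from the one of order $P$ by the series of
  $\Delta^jG_0(k)$ for finitely many $j>p$, with coefficients that depend on $x$ only and are bounded on
  bounded sets. These series telescope, and their partial sums converge because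
  $\Delta^{j-1}G_0(n)$ tends to $0$. Thus derivatives of order greater than $p$ can be handled with the
  larger order $P$.
\<close>

lemma remainder_series_uniform_limit:
  assumes der: "\<And>i x. i < m \<Longrightarrow> 0 < x \<Longrightarrow> (G i has_real_derivative G (Suc i) x) (at x)"
    and D: "G 0 \<in> class_D p" and K: "G 0 \<in> class_K P" and le: "m \<le> P" "p \<le> P"
    and B: "bounded B" "B \<subseteq> {0..}"
  shows "uniform_limit B (\<lambda>n x. \<Sum>i<n. remainder G p m (Suc i) x)
    (\<lambda>x. \<Sum>i. remainder G p m (Suc i) x) sequentially"
proof -
  define d where "d j n = (fwd_diff ^^ j) (G 0) (real (Suc n))" for j n
  have "G 0 \<in> class_D P \<inter> class_K P"
    using fwd_diff_tendsto_0 [OF D le(2)] K by (simp add: class_D_def)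
  then have P: "uniform_limit B (\<lambda>n x. \<Sum>i<n. remainder G P m (Suc i) x)
      (\<lambda>x. \<Sum>i. remainder G P m (Suc i) x) sequentially"
    by (intro remainder_series_uniform_limit_same_order der le B) auto
  have lim: "uniform_limit B
      (\<lambda>n x. (\<Sum>i<n. remainder G P m (Suc i) x) + (\<Sum>j\<in>{p<..P}. binom_deriv m j x * (d (j - 1) n - d (j - 1) 0)))
      (\<lambda>x. (\<Sum>i. remainder G P m (Suc i) x) + (\<Sum>j\<in>{p<..P}. binom_deriv m j x * (0 - d (j - 1) 0)))
      sequentially"
  proof (intro uniform_limit_add P uniform_limit_finite_sum uniform_lim_mult uniform_limit_const
      uniform_limit_of_constants bounded_binom_deriv B(1) tendsto_diff tendsto_const)
    fix j assume "j \<in> {p<..P}"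
    then have "p \<le> j - 1" by auto
    then show "d (j - 1) \<longlonglongrightarrow> 0"
      unfolding d_def by (intro LIMSEQ_Suc fwd_diff_tendsto_0 [OF D])
    show "bounded ((\<lambda>x. 0 - d (j - 1) 0) ` B)"
      by (rule bounded_subset [of "{0 - d (j - 1) 0}"]) auto
  qed
  have eq: "(\<Sum>i<n. remainder G P m (Suc i) x) + (\<Sum>j\<in>{p<..P}. binom_deriv m j x * (d (j - 1) n - d (j - 1) 0))
      = (\<Sum>i<n. remainder G p m (Suc i) x)" for n x
  proof -
    have tele: "(\<Sum>i<n. d j i) = d (j - 1) n - d (j - 1) 0" if "j \<in> {p<..P}" for j
    proof -
      have "j = Suc (j - 1)" using that by auto
      then have "d j i = d (j - 1) (Suc i) - d (j - 1) i" for i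
        unfolding d_def by (metis (no_types) comp_apply funpow.simps(2) fwd_diff_def of_nat_Suc add.commute)
      then show ?thesis by (simp add: sum_lessThan_telescope)
    qed
    have "(\<Sum>i<n. remainder G p m (Suc i) x) = (\<Sum>i<n. remainder G P m (Suc i) x)
        + (\<Sum>i<n. \<Sum>j\<in>{p<..P}. binom_deriv m j x * d j i)"
      unfolding remainder_order [OF le(2), of G m] d_def by (simp add: sum.distrib)
    also have "(\<Sum>i<n. \<Sum>j\<in>{p<..P}. binom_deriv m j x * d j i) =
        (\<Sum>j\<in>{p<..P}. binom_deriv m j x * (\<Sum>i<n. d j i))"
      by (subst sum.swap) (simp add: sum_distrib_left)
    finally show ?thesis by (simp add: tele)
  qed
  from lim have "uniform_limit B (\<lambda>n x. \<Sum>i<n. remainder G p m (Suc i) x)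
      (\<lambda>x. (\<Sum>i. remainder G P m (Suc i) x) + (\<Sum>j\<in>{p<..P}. binom_deriv m j x * (0 - d (j - 1) 0)))
      sequentially"
    unfolding eq .
  then show ?thesis
    by (intro uniform_limit_suminf uniformly_convergentI)
qed

section \<open>Termwise differentiation and integration\<close>

text \<open>
  Iterated derivatives of total functions are determined on the open half-line by any sequence of
  functions that are successive derivatives there, whatever happens elsewhere.
\<close>

lemma higher_deriv_eq:
  assumes "\<And>i x. i < r \<Longrightarrow> 0 < x \<Longrightarrow> (F i has_real_derivative F (Suc i) x) (at x)"
    and "\<And>x. 0 < x \<Longrightarrow> f x = F 0 x" and "m \<le> r" "0 < x"
  shows "(deriv ^^ m) f x = F m x"
  using assms(3,4)
proof (induction m arbitrary: x)
  case 0 then show ?case using assms(2) by simp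
next
  case (Suc m)
  have "(F m has_real_derivative F (Suc m) x) (at x)"
    using assms(1) Suc.prems by simp
  then have "((deriv ^^ m) f has_real_derivative F (Suc m) x) (at x)"
    by (rule has_field_derivative_transform_within_open [of _ _ _ "{0<..}"])
      (use Suc in auto)
  then show ?case by (simp add: DERIV_imp_deriv)
qed

lemma class_C_I:
  assumes der: "\<And>i x. i < r \<Longrightarrow> 0 < x \<Longrightarrow> (F i has_real_derivative F (Suc i) x) (at x)"
    and f: "\<And>x. 0 < x \<Longrightarrow> f x = F 0 x" and cont: "continuous_on {0<..} (F r)"
  shows "f \<in> class_C r"
proof -
  have eq: "(deriv ^^ m) f x = F m x" if "m \<le> r" "0 < x" for m x
    using higher_deriv_eq [OF der f that] by simp
  have "continuous_on {0<..} ((deriv ^^ r) f)"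
    using cont by (rule continuous_on_cong [THEN iffD2, rotated -1]) (auto simp: eq)
  moreover have "(deriv ^^ m) f differentiable_on {0<..}" if "m < r" for m
    unfolding differentiable_on_def
  proof
    fix x :: real assume x: "x \<in> {0<..}"
    have "((deriv ^^ m) f has_real_derivative F (Suc m) x) (at x)"
      by (rule has_field_derivative_transform_within_open [OF der [OF that], of x "{0<..}"])
        (use that x in \<open>auto simp: eq\<close>)
    then show "(deriv ^^ m) f differentiable at x within {0<..}"
      by (meson differentiable_at_withinI has_field_derivative_imp_has_derivative differentiableI)
  qed
  ultimately show ?thesis by (simp add: class_C_def)
qed

lemma class_C_has_derivative:
  assumes "f \<in> class_C r" "m < r" "0 < x"
  shows "((deriv ^^ m) f has_real_derivative (deriv ^^ Suc m) f x) (at x)"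
proof -
  have "(deriv ^^ m) f differentiable (at x within {0<..})"
    using assms by (auto simp: class_C_def differentiable_on_def)
  then have "(deriv ^^ m) f differentiable (at x)"
    using assms(3) by (simp add: at_within_open [of x "{0<..}"])
  then show ?thesis
    by (simp add: DERIV_deriv_iff_real_differentiable)
qed

lemma series_has_derivative:
  fixes T :: "nat \<Rightarrow> nat \<Rightarrow> real \<Rightarrow> real"
  assumes der: "\<And>i x. 0 < x \<Longrightarrow> (T m i has_real_derivative T (Suc m) i x) (at x)"
    and lim: "\<And>k B. k \<in> {m, Suc m} \<Longrightarrow> bounded B \<Longrightarrow> B \<subseteq> {0..} \<Longrightarrow>
      uniform_limit B (\<lambda>n x. \<Sum>i<n. T k i x) (\<lambda>x. \<Sum>i. T k i x) sequentially"
    and x: "0 < x"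
  shows "((\<lambda>x. \<Sum>i. T m i x) has_real_derivative (\<Sum>i. T (Suc m) i x)) (at x)"
proof (rule has_field_derivative_series' [where S = "{0<..<x + 1}"])
  show "uniformly_convergent_on {0<..<x + 1} (\<lambda>n x. \<Sum>i<n. T (Suc m) i x)"
    by (rule uniformly_convergentI [OF lim]) auto
  have "(\<lambda>n. \<Sum>i<n. T m i x) \<longlonglongrightarrow> (\<Sum>i. T m i x)"
    using tendsto_uniform_limitI [OF lim [of m "{x}"], of x] x by simp
  then show "summable (\<lambda>i. T m i x)"
    by (auto simp: summable_def sums_def)
  show "(T m i has_real_derivative T (Suc m) i y) (at y within {0<..<x + 1})"
    if "y \<in> {0<..<x + 1}" for i y
    by (rule has_field_derivative_at_within [OF der]) (use that in simp)
qed (use x in auto)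

lemma continuous_on_uniform_series:
  fixes T :: "nat \<Rightarrow> real \<Rightarrow> real"
  assumes cont: "\<And>i. continuous_on {0..} (T i)"
    and lim: "\<And>B. bounded B \<Longrightarrow> B \<subseteq> {0..} \<Longrightarrow>
      uniform_limit B (\<lambda>n x. \<Sum>i<n. T i x) S sequentially"
  shows "continuous_on {0..} S"
proof -
  have *: "continuous_on {0..b} S" for b
  proof (rule uniform_limit_theorem)
    show "uniform_limit {0..b} (\<lambda>n x. \<Sum>i<n. T i x) S sequentially"
      by (rule lim) auto
    show "\<forall>\<^sub>F n in sequentially. continuous_on {0..b} (\<lambda>x. \<Sum>i<n. T i x)"
      by (intro always_eventually allI continuous_on_sum continuous_on_subset [OF cont]) auto
  qed simp
  show ?thesis
    unfolding continuous_on_eq_continuous_within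
  proof
    fix x :: real assume x: "x \<in> {0..}"
    have "continuous (at x within {0..x + 1}) S"
      using * [of "x + 1"] x by (simp add: continuous_on_eq_continuous_within)
    moreover have "at x within {0..x + 1} = at x within {0..}"
      by (rule at_within_nhd [of _ "{..<x + 1}"]) auto
    ultimately show "continuous (at x within {0..}) S" by simp
  qed
qed

lemma integral_from_base_point_has_derivative:
  fixes f :: "real \<Rightarrow> real"
  assumes "continuous_on {a..b} f" "c \<in> {a..b}" "x \<in> {a..b}"
  shows "((\<lambda>u. LBINT t=ereal c..ereal u. f t) has_real_derivative f x) (at x within {a..b})"
  using interval_integral_FTC2 [of a c b f x] assms
  by (simp add: has_real_derivative_iff_has_vector_derivative)

text \<open>
  One integration preserves uniform convergence on a bounded interval: the error of the integrated
  partial sum vanishes at the base point, and its derivative is the error of the original partial sum,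
  so the mean value inequality bounds it by the length of the interval times the original error.
\<close>

lemma iterated_integral_uniform_series:
  fixes h :: "nat \<Rightarrow> real \<Rightarrow> real"
  assumes "\<And>i. continuous_on {a..b} (h i)"
    and "uniform_limit {a..b} (\<lambda>n x. \<Sum>i<n. h i x) H sequentially"
    and "set cs \<subseteq> {a..b}"
  shows "(\<forall>i. continuous_on {a..b} (iterated_integral cs (h i))) \<and>
    continuous_on {a..b} (iterated_integral cs H) \<and>
    uniform_limit {a..b} (\<lambda>n x. \<Sum>i<n. iterated_integral cs (h i) x) (iterated_integral cs H) sequentially"
  using assms(3)
proof (induction cs)
  case Nil
  have "continuous_on {a..b} H"
    by (rule uniform_limit_theorem [OF _ assms(2)])
      (auto intro!: always_eventually continuous_on_sum assms(1))
  then show ?case using assms by simp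
next
  case (Cons c cs)
  define I where "I f = iterated_integral cs f" for f
  define J where "J f = iterated_integral (c # cs) f" for f
  have c: "c \<in> {a..b}" using Cons.prems by simp
  have cont_h: "\<And>i. continuous_on {a..b} (I (h i))"
    and cont_H: "continuous_on {a..b} (I H)"
    and lim: "uniform_limit {a..b} (\<lambda>n x. \<Sum>i<n. I (h i) x) (I H) sequentially"
    using Cons unfolding I_def by auto
  have der_h: "(J (h i) has_real_derivative I (h i) x) (at x within {a..b})" if "x \<in> {a..b}" for i x
    using integral_from_base_point_has_derivative [OF cont_h c that] unfolding J_def I_def by simp
  have der_H: "(J H has_real_derivative I H x) (at x within {a..b})" if "x \<in> {a..b}" for x
    using integral_from_base_point_has_derivative [OF cont_H c that] unfolding J_def I_def by simp
  have "uniform_limit {a..b} (\<lambda>n x. \<Sum>i<n. J (h i) x) (J H) sequentially"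
  proof (rule uniform_limitI)
    fix e :: real assume "e > 0"
    \<comment> \<open>The summand $1$ in the divisor covers degenerate intervals and yields a strict inequality.\<close>
    define e' where "e' = e / (b - a + 1)"
    have ab: "b - a + 1 > 0" using c by simp
    have "e' > 0" using \<open>e > 0\<close> ab by (simp add: e'_def)
    from uniform_limitD [OF lim this]
    show "\<forall>\<^sub>F n in sequentially. \<forall>x\<in>{a..b}. dist (\<Sum>i<n. J (h i) x) (J H x) < e"
    proof eventually_elim
      case (elim n)
      define E where "E x = (\<Sum>i<n. J (h i) x) - J H x" for x
      show ?case
      proof
        fix x assume x: "x \<in> {a..b}"
        have "norm (E x - E c) \<le> e' * norm (x - c)"
        proof (rule field_differentiable_bound [of "{a..b}" E "\<lambda>x. (\<Sum>i<n. I (h i) x) - I H x"])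
          fix y assume y: "y \<in> {a..b}"
          show "(E has_real_derivative (\<Sum>i<n. I (h i) y) - I H y) (at y within {a..b})"
            unfolding E_def [abs_def] by (intro DERIV_diff DERIV_sum der_h der_H y)
          show "norm ((\<Sum>i<n. I (h i) y) - I H y) \<le> e'"
            using elim y by (auto simp: dist_norm less_imp_le)
        qed (use x c in auto)
        also have "E c = 0" by (simp add: E_def J_def)
        also have "e' * norm (x - c) < e' * (b - a + 1)"
          using \<open>e' > 0\<close> x c by (intro mult_strict_left_mono) auto
        also have "e' * (b - a + 1) = e" using ab by (simp add: e'_def)
        finally show "dist (\<Sum>i<n. J (h i) x) (J H x) < e" by (simp add: E_def dist_norm)
      qed
    qed
  qed
  moreover have "continuous_on {a..b} (J (h i))" for i
    using der_h by (rule DERIV_continuous_on)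
  moreover have "continuous_on {a..b} (J H)"
    using der_H by (rule DERIV_continuous_on)
  ultimately show ?case by (simp add: J_def)
qed

lemma remainder_continuous_on:
  assumes "continuous_on {0<..} (G m)" "1 \<le> k"
  shows "continuous_on {0..} (remainder G p m k)"
proof -
  have "continuous_on {0..} (\<lambda>x. G m (x + real k))"
    by (rule continuous_on_compose2 [OF assms(1)]) (use assms(2) in \<open>auto intro!: continuous_intros\<close>)
  then show ?thesis
    unfolding remainder_def [abs_def]
    by (intro continuous_intros binom_deriv_continuous)
qed

section \<open>The principal indefinite sum\<close>

text \<open>
  Telescoping in $n$: the increment of the binomial part of the defining sequence is its analogue with
  $\Delta^jg(n)$, which together with $g(n)-g(x+n)$ gives minus the $n$-th term of the series.
\<close>

lemma Sigma_seq_eq_partial_sum: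
  "Sigma_seq p g (Suc n) x = - g x + (\<Sum>j=1..p. (x gchoose j) * (fwd_diff ^^ (j - 1)) g 1)
    - (\<Sum>i<n. series_term p g (Suc i) x)"
proof (induction n)
  case 0 then show ?case by (simp add: Sigma_seq_def)
next
  case (Suc n)
  define k where "k = Suc n"
  have "{1..Suc k - 1} = insert k {1..k - 1}" "k \<notin> {1..k - 1}"
    by (auto simp: k_def)
  then have split: "(\<Sum>i=1..Suc k - 1. g (real i) - g (x + real i)) =
      (g (real k) - g (x + real k)) + (\<Sum>i=1..k - 1. g (real i) - g (x + real i))"
    by simp
  have "(\<Sum>j=1..p. (x gchoose j) * (fwd_diff ^^ (j - 1)) g (real (Suc k))) -
      (\<Sum>j=1..p. (x gchoose j) * (fwd_diff ^^ (j - 1)) g (real k)) =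
      (\<Sum>j=1..p. (x gchoose j) * (fwd_diff ^^ j) g (real k))"
    unfolding sum_subtractf [symmetric]
  proof (rule sum.cong)
    fix j assume "j \<in> {1..p}"
    then obtain i where "j = Suc i" by (cases j) auto
    then show "(x gchoose j) * (fwd_diff ^^ (j - 1)) g (real (Suc k)) -
        (x gchoose j) * (fwd_diff ^^ (j - 1)) g (real k) = (x gchoose j) * (fwd_diff ^^ j) g (real k)"
      by (simp add: fwd_diff_def algebra_simps)
  qed simp
  moreover have "{0..p} = insert 0 {1..p}" by auto
  then have "series_term p g k x =
      g (x + real k) - g (real k) - (\<Sum>j=1..p. (x gchoose j) * (fwd_diff ^^ j) g (real k))"
    by (simp add: series_term_def)
  ultimately have "Sigma_seq p g (Suc k) x = Sigma_seq p g k x - series_term p g k x"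
    unfolding Sigma_seq_def split by linarith
  then show ?case using Suc.IH by (simp add: k_def)
qed

lemma Sigma_seq_order_irrelevant:
  assumes "g \<in> class_D p" "p \<le> q"
  shows "(\<lambda>n. Sigma_seq q g n x - Sigma_seq p g n x) \<longlonglongrightarrow> 0"
proof -
  have "{1..q} = {1..p} \<union> {p<..q}" "{1..p} \<inter> {p<..q} = {}" using assms(2) by auto
  then have "Sigma_seq q g n x - Sigma_seq p g n x =
      (\<Sum>j\<in>{p<..q}. (x gchoose j) * (fwd_diff ^^ (j - 1)) g (real n))" for n
    by (simp add: Sigma_seq_def sum.union_disjoint)
  moreover have "(\<lambda>n. \<Sum>j\<in>{p<..q}. (x gchoose j) * (fwd_diff ^^ (j - 1)) g (real n))
      \<longlonglongrightarrow> (\<Sum>j\<in>{p<..q}. (x gchoose j) * 0)"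
    using assms(1) by (intro tendsto_intros fwd_diff_tendsto_0) auto
  ultimately show ?thesis by simp
qed

text \<open>
  The definition of the principal sum chooses some admissible order. Any other admissible order gives
  the same limit, since the two sequences differ by multiples of $\Delta^{j-1}g(n)$ with $j-1$ at least
  the smaller order, and these tend to $0$.
\<close>

lemma principal_sum_eqI:
  assumes "g \<in> class_D p \<inter> class_K p" "(\<lambda>n. Sigma_seq p g n x) \<longlonglongrightarrow> l"
  shows "principal_sum g x = l"
proof -
  define q where "q = (SOME q. g \<in> class_D q \<inter> class_K q)"
  have q: "g \<in> class_D q"
    using someI [of "\<lambda>q. g \<in> class_D q \<inter> class_K q", OF assms(1)] by (simp add: q_def)
  have "(\<lambda>n. Sigma_seq q g n x - Sigma_seq p g n x) \<longlonglongrightarrow> 0"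
  proof (cases "p \<le> q")
    case True then show ?thesis using assms(1) by (intro Sigma_seq_order_irrelevant) auto
  next
    case False
    then show ?thesis
      using tendsto_minus [OF Sigma_seq_order_irrelevant [OF q, of p x]] by simp
  qed
  from tendsto_add [OF this assms(2)] have "(\<lambda>n. Sigma_seq q g n x) \<longlonglongrightarrow> l" by simp
  then show ?thesis by (simp add: principal_sum_def q_def limI)
qed

theorem theorem8p2:
  fixes g :: "real \<Rightarrow> real" and p :: nat
  assumes "g \<in> class_D p \<inter> class_K p"
  shows
    "(\<forall>x>0. principal_sum g x =
         - g x + (\<Sum>j=1..p. (x gchoose j) * (fwd_diff ^^ (j - 1)) g 1) - series_sum p g x) \<and>
     (\<forall>B. bounded B \<and> B \<subseteq> {0..} \<longrightarrow>
         uniform_limit B (\<lambda>n x. \<Sum>k=1..n. series_term p g k x) (series_sum p g) sequentially) \<and>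
     (g \<in> class_C 0 \<longrightarrow>
         principal_sum g \<in> class_C 0 \<and>
         (\<forall>a b cs. 0 \<le> a \<and> a \<le> b \<and> set cs \<subseteq> {a..b} \<longrightarrow>
            (\<forall>k\<ge>1. interval_lebesgue_integrable lborel (ereal a) (ereal b)
                     (iterated_integral cs (series_term p g k))) \<and>
            interval_lebesgue_integrable lborel (ereal a) (ereal b)
              (iterated_integral cs (series_sum p g)) \<and>
            (\<lambda>k. LBINT x=ereal a..ereal b. iterated_integral cs (series_term p g (Suc k)) x)
              sums (LBINT x=ereal a..ereal b. iterated_integral cs (series_sum p g) x))) \<and>
     (\<forall>r. g \<in> class_C r \<inter> class_K (max p r) \<longrightarrow>
         principal_sum g \<in> class_C r \<and>
         (\<forall>k\<ge>1. series_term p g k \<in> class_C r) \<and>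
         series_sum p g \<in> class_C r \<and>
         (\<forall>m\<le>r. \<forall>x>0. (\<lambda>k. (deriv ^^ m) (series_term p g (Suc k)) x)
                          sums (deriv ^^ m) (series_sum p g) x))"
proof -
  define G where "G i = (deriv ^^ i) g" for i
  define T where "T m i = remainder G p m (Suc i)" for m i
  define S where "S m x = (\<Sum>i. T m i x)" for m x
  define Q where "Q m x = (\<Sum>j=1..p. binom_deriv m j x * (fwd_diff ^^ (j - 1)) g 1)" for m x
  have G0: "G 0 = g" by (simp add: G_def)
  have term_eq: "series_term p g k = remainder G p 0 k" for k
    by (rule ext) (simp add: series_term_def remainder_def G0 atLeast0AtMost)
  have sum_eq: "series_sum p g = S 0"
    by (rule ext) (simp add: series_sum_def S_def T_def term_eq)
  have lim: "uniform_limit B (\<lambda>n x. \<Sum>i<n. T m i x) (S m) sequentially"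
    if "bounded B" "B \<subseteq> {0..}" "m \<le> r" "g \<in> class_C r" "g \<in> class_K (max p r)" for B m r
    unfolding T_def S_def [abs_def]
  proof (rule remainder_series_uniform_limit [where P = "max p r"])
    \<comment> \<open>The order $\max(p,r)$ leaves room for $m\le r$ differentiations even if $r>p$.\<close>
    show "(G i has_real_derivative G (Suc i) x) (at x)" if "i < m" "0 < x" for i x
      using class_C_has_derivative [OF \<open>g \<in> class_C r\<close>, of i x] that \<open>m \<le> r\<close>
      unfolding G_def by simp
  qed (use assms that in \<open>auto simp: G0\<close>)
  have lim0: "uniform_limit B (\<lambda>n x. \<Sum>i<n. T 0 i x) (S 0) sequentially"
    if "bounded B" "B \<subseteq> {0..}" for B
    unfolding T_def S_def [abs_def]
    by (rule remainder_series_uniform_limit [where P = p]) (use assms that in \<open>auto simp: G0\<close>)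

  have principal: "principal_sum g x = - g x + Q 0 x - S 0 x" if "0 < x" for x
  proof (rule principal_sum_eqI [OF assms])
    have "(\<lambda>n. \<Sum>i<n. T 0 i x) \<longlonglongrightarrow> S 0 x"
      using tendsto_uniform_limitI [OF lim0 [of "{x}"], of x] that by simp
    then have "(\<lambda>n. Sigma_seq p g (Suc n) x) \<longlonglongrightarrow> - g x + Q 0 x - S 0 x"
      unfolding Sigma_seq_eq_partial_sum term_eq T_def Q_def binom_deriv_0
      by (intro tendsto_intros)
    then show "(\<lambda>n. Sigma_seq p g n x) \<longlonglongrightarrow> - g x + Q 0 x - S 0 x"
      by (rule LIMSEQ_imp_Suc)
  qed

  have part_c: "principal_sum g \<in> class_C r \<and> (\<forall>k\<ge>1. series_term p g k \<in> class_C r) \<and>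
      series_sum p g \<in> class_C r \<and>
      (\<forall>m\<le>r. \<forall>x>0. (\<lambda>k. (deriv ^^ m) (series_term p g (Suc k)) x) sums (deriv ^^ m) (series_sum p g) x)"
    if C: "g \<in> class_C r" and K: "g \<in> class_K (max p r)" for r
  proof -
    have derG: "(G i has_real_derivative G (Suc i) x) (at x)" if "i < r" "0 < x" for i x
      using class_C_has_derivative [OF C that] by (simp add: G_def)
    have contG: "continuous_on {0<..} (G r)"
      using C by (simp add: class_C_def G_def)
    have derR: "(remainder G p i k has_real_derivative remainder G p (Suc i) k x) (at x)"
      if "i < r" "0 < x" for i k x
      using that by (intro remainder_has_derivative derG) auto
    have derS: "(S i has_real_derivative S (Suc i) x) (at x)" if "i < r" "0 < x" for i x
      unfolding S_def [abs_def]
    proof (rule series_has_derivative [OF _ _ \<open>0 < x\<close>])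
      show "(T i j has_real_derivative T (Suc i) j y) (at y)" if "0 < y" for j y
        unfolding T_def by (rule derR [OF \<open>i < r\<close> that])
      show "uniform_limit B (\<lambda>n x. \<Sum>j<n. T k j x) (\<lambda>x. \<Sum>j. T k j x) sequentially"
        if "k \<in> {i, Suc i}" "bounded B" "B \<subseteq> {0..}" for k B
        using lim [OF that(2,3), of k r] that(1) \<open>i < r\<close> C K by (auto simp: S_def [abs_def])
    qed
    have contT: "continuous_on {0..} (T r i)" for i
      unfolding T_def by (rule remainder_continuous_on [where G = G, OF contG]) simp
    have contS: "continuous_on {0<..} (S r)"
    proof (rule continuous_on_subset)
      show "continuous_on {0..} (S r)"
        by (rule continuous_on_uniform_series [OF contT]) (rule lim [OF _ _ _ C K], auto)
    qed auto
    have "series_term p g k \<in> class_C r" if "1 \<le> k" for k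
    proof (rule class_C_I [of r "\<lambda>i. remainder G p i k"])
      show "continuous_on {0<..} (remainder G p r k)"
        by (rule continuous_on_subset [OF remainder_continuous_on [where G = G, OF contG that]]) auto
    qed (use derR in \<open>auto simp: term_eq\<close>)
    moreover have "series_sum p g \<in> class_C r"
      using derS contS by (intro class_C_I [of r S]) (auto simp: sum_eq)
    moreover have "principal_sum g \<in> class_C r"
    proof (rule class_C_I [of r "\<lambda>i x. - G i x + Q i x - S i x"])
      show "((\<lambda>x. - G i x + Q i x - S i x) has_real_derivative - G (Suc i) x + Q (Suc i) x - S (Suc i) x) (at x)"
        if "i < r" "0 < x" for i x
        unfolding Q_def
        by (intro DERIV_diff DERIV_add DERIV_minus DERIV_sum DERIV_cmult_right
            binom_deriv_has_derivative derG derS that)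
      show "continuous_on {0<..} (\<lambda>x. - G r x + Q r x - S r x)"
        unfolding Q_def by (intro continuous_intros contG contS binom_deriv_continuous)
      show "principal_sum g x = - G 0 x + Q 0 x - S 0 x" if "0 < x" for x
        using principal [OF that] by (simp add: G0)
    qed
    moreover have "(\<lambda>k. (deriv ^^ m) (series_term p g (Suc k)) x) sums (deriv ^^ m) (series_sum p g) x"
      if "m \<le> r" "0 < x" for m x
    proof -
      have "(deriv ^^ m) (series_term p g (Suc k)) x = T m k x" for k
        unfolding T_def
        by (rule higher_deriv_eq [of r "\<lambda>i. remainder G p i (Suc k)"]) (use derR that in \<open>auto simp: term_eq\<close>)
      moreover have "(deriv ^^ m) (series_sum p g) x = S m x"
        by (rule higher_deriv_eq [of r S]) (use derS that in \<open>auto simp: sum_eq\<close>)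
      moreover have "(\<lambda>k. T m k x) sums S m x"
        using tendsto_uniform_limitI [OF lim [of "{x}" m r], of x] that C K by (simp add: sums_def)
      ultimately show ?thesis by simp
    qed
    ultimately show ?thesis by blast
  qed

  have part_b: "(\<forall>k\<ge>1. interval_lebesgue_integrable lborel (ereal a) (ereal b)
                     (iterated_integral cs (series_term p g k))) \<and>
            interval_lebesgue_integrable lborel (ereal a) (ereal b)
              (iterated_integral cs (series_sum p g)) \<and>
            (\<lambda>k. LBINT x=ereal a..ereal b. iterated_integral cs (series_term p g (Suc k)) x)
              sums (LBINT x=ereal a..ereal b. iterated_integral cs (series_sum p g) x)"
    if C: "g \<in> class_C 0" and ab: "0 \<le> a" "a \<le> b" "set cs \<subseteq> {a..b}" for a b cs
  proof -
    have contG: "continuous_on {0<..} (G 0)"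
      using C by (simp add: class_C_def G_def)
    have cont: "continuous_on {a..b} (T 0 i)" for i
      unfolding T_def
      by (rule continuous_on_subset [OF remainder_continuous_on [where G = G, OF contG]]) (use ab in auto)
    have unif: "uniform_limit {a..b} (\<lambda>n x. \<Sum>i<n. T 0 i x) (S 0) sequentially"
      by (rule lim0) (use ab in auto)
    note I = iterated_integral_uniform_series [OF cont unif]
    have int: "interval_lebesgue_integrable lborel (ereal a) (ereal b) (iterated_integral cs (T 0 i))"
      "interval_lebesgue_integrable lborel (ereal a) (ereal b) (iterated_integral cs (S 0))" for i
      using I [OF ab(3)] ab(2) by (auto intro: interval_integrable_continuous_on)
    \<comment> \<open>The outer integral from $a$ to $b$ is one more iterated integral, evaluated at $b$.\<close>
    have "set (a # cs) \<subseteq> {a..b}" using ab by auto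
    from I [OF this] have "uniform_limit {a..b} (\<lambda>n x. \<Sum>i<n. iterated_integral (a # cs) (T 0 i) x)
        (iterated_integral (a # cs) (S 0)) sequentially" by blast
    from tendsto_uniform_limitI [OF this, of b]
    have "(\<lambda>i. iterated_integral (a # cs) (T 0 i) b) sums iterated_integral (a # cs) (S 0) b"
      using ab by (simp add: sums_def)
    moreover have "interval_lebesgue_integrable lborel (ereal a) (ereal b)
        (iterated_integral cs (series_term p g k))" if "1 \<le> k" for k
      using int(1) [of "k - 1"] that by (simp add: T_def term_eq)
    ultimately show ?thesis
      using int(2) by (simp add: T_def term_eq sum_eq)
  qed

  have part_a: "uniform_limit B (\<lambda>n x. \<Sum>k=1..n. series_term p g k x) (series_sum p g) sequentially"
    if "bounded B" "B \<subseteq> {0..}" for B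
    using lim0 [OF that] by (simp add: sum_eq term_eq T_def sum.atLeast1_atMost_eq)
  have "g \<in> class_K (max p 0)" using assms by simp
  with part_a part_b part_c principal show ?thesis
    by (auto simp: sum_eq Q_def)
qed

end
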